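(* (1) Let $n=p_1^{n_1}p_2^{n_2}p_3^{n_3}$, where $p_1,p_2,p_3$ are distinct odd primes and $n_1,n_2,n_3\geq 1$ are integers, and let $C_2(H)$ be the binary code generated by an incidence matrix $H$ of the unit graph $G(\mathbb{Z}_n)$. Then the dual code $C_2(H)^{\perp}$ is a $\left[\frac{(n-1)\phi(n)}{2},\,\frac{(n-1)[\phi(n)-2]}{2},\,3\right]_{2}$ code. (2) Let $n=2^{m}p_1^{n_1}p_2^{n_2}$, where $p_1,p_2$ are distinct odd primes and $m,n_1,n_2\geq 1$ are integers, let $q$ be an odd prime, and let $C_q(H)$ be the $q$-ary code generated by an incidence matrix $H$ of the unit graph $G(\mathbb{Z}_n)$. Then the dual code $C_q(H)^{\perp}$ is a $\left[\frac{n\phi(n)}{2},\,\frac{n(\phi(n)-2)+2}{2},\,4\right]_{q}$ code.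
   Context: The unit graph $G(\mathbb{Z}_n)$ is the simple graph with vertex set $\mathbb{Z}_n$ in which two distinct vertices $x,y$ are adjacent iff $x+y$ is a unit of $\mathbb{Z}_n$. An incidence matrix of a graph $(V,E)$ has rows indexed by vertices and columns by edges, with entry $1$ if the vertex is an endpoint of the edge and $0$ otherwise. For a prime $q$, $C_q(H)$ denotes the $\mathbb{F}_q$-span of the rows of $H$ (entries read in $\mathbb{F}_q$), a subspace of $\mathbb{F}_q^{|E|}$. The dual $C^\perp$ of a code $C\subseteq\mathbb{F}_q^N$ is its orthogonal complement with respect to the standard bilinear form. An $[N,k,d]_q$ code is a linear subspace of $\mathbb{F}_q^N$ of dimension $k$ whose minimum Hamming weight of nonzero vectors (equivalently, minimum distance) is $d$. $\phi$ is Euler's totient function. *)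

theory Defs
  imports
    "HOL-Library.Cardinality"
    "HOL-Number_Theory.Residues"
    "Jordan_Normal_Form.DL_Rank"
begin

text \<open>A simple graph is a pair of its vertex set and its set of edges, each edge being the
  two-element set of its endpoints.\<close>

type_synonym 'v simple_graph = "'v set \<times> 'v set set"

definition unit_graph :: "('v, 'm) ring_scheme \<Rightarrow> 'v simple_graph" where
  "unit_graph R =
    (carrier R,
     {{x, y} | x y. x \<in> carrier R \<and> y \<in> carrier R \<and> x \<noteq> y \<and> x \<oplus>\<^bsub>R\<^esub> y \<in> Units R})"

text \<open>An incidence matrix depends on an enumeration \<open>vs\<close> of the vertices and an enumeration
  \<open>es\<close> of the edges; every choice of these gives an incidence matrix of the graph.\<close>

definition is_incidence_matrix :: "int mat \<Rightarrow> 'v simple_graph \<Rightarrow> bool" where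
  "is_incidence_matrix H G \<longleftrightarrow>
    (\<exists>vs es. distinct vs \<and> set vs = fst G \<and> distinct es \<and> set es = snd G \<and>
       H = mat (length vs) (length es) (\<lambda>(i, j). if vs ! i \<in> es ! j then 1 else 0))"

text \<open>Codes over the field with \<open>q\<close> elements are sets of vectors over a type \<open>'f\<close> of
  class \<open>field\<close> with \<open>q\<close> elements. In particular \<open>code_of H :: 'f vec set\<close> is the code
  $C_q(H)$ where \<open>q = CARD('f)\<close>.\<close>

definition code_of :: "int mat \<Rightarrow> 'f::field vec set" where
  "code_of H = vec_space.row_space (dim_col H) (map_mat of_int H)"

definition hamming_weight :: "'f::zero vec \<Rightarrow> nat" where
  "hamming_weight v = card {i. i < dim_vec v \<and> v $ i \<noteq> 0}"

text \<open>\<open>is_code q N k d C\<close> says that \<open>C\<close> is an $[N,k,d]_q$ code.\<close>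

definition is_code :: "nat \<Rightarrow> nat \<Rightarrow> nat \<Rightarrow> nat \<Rightarrow> 'f::field vec set \<Rightarrow> bool" where
  "is_code q N k d C \<longleftrightarrow>
     CARD('f) = q \<and>
     VectorSpace.subspace class_ring C (module_vec TYPE('f) N) \<and>
     vectorspace.dim class_ring (module_vec TYPE('f) N\<lparr>carrier := C\<rparr>) = k \<and>
     (\<exists>c\<in>C. c \<noteq> 0\<^sub>v N \<and> hamming_weight c = d) \<and>
     (\<forall>c\<in>C. c \<noteq> 0\<^sub>v N \<longrightarrow> d \<le> hamming_weight c)"

abbreviation dual_code :: "nat \<Rightarrow> 'f::field vec set \<Rightarrow> 'f vec set" where
  "dual_code N C \<equiv> vec_module.orthogonal_complement N C"

end

(*
  The dual code is the kernel of the incidence matrix H over the field, so its dimension is the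
  number of edges minus the rank of H. A vector f on the vertices annihilates H iff f x + f y = 0
  on every edge; since 1 and -1 are units, such an f satisfies f x = f (x - 2) and f 0 + f 1 = 0,
  so there is at most one up to scaling. In characteristic 2 the constant 1 is one, and for even n
  the sign of the parity is one, so H has rank n - 1. A nonzero word of the dual is supported on
  edges that form a graph without vertices of degree 1; such a graph contains a triangle or has at
  least four edges. For even n the unit graph is bipartite, so the minimum weight is at least 4.
  A triangle, respectively a 4-cycle with alternating signs, attains the bound; both are found by
  the Chinese remainder theorem, as some prime factor of n is at least 5.
*)

theory Submission
  imports Defs "Jordan_Normal_Form.Matrix_Kernel"
begin

section \<open>Kernel dimensions over a field, and dual codes as kernels\<close>

text \<open>Gauss-Jordan elimination gives an echelon form \<open>C = P * A\<close> with
  \<open>P\<close> invertible and the same kernel. A zero row of \<open>C\<close> makes the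
  corresponding row of \<open>P\<close> a linear relation among the rows of \<open>A\<close>, hence
  zero, which contradicts invertibility. So all \<open>nr\<close> rows carry a pivot.\<close>

lemma kernel_dim_full_row_rank:
  fixes A :: "'a::field mat"
  assumes A: "A \<in> carrier_mat nr nc"
    and indep: "\<And>f. f \<in> carrier_vec nr \<Longrightarrow> A\<^sup>T *\<^sub>v f = 0\<^sub>v nc \<Longrightarrow> f = 0\<^sub>v nr"
  shows "kernel.dim nc A = nc - nr"
proof -
  obtain C where "gauss_jordan_single A = C" by auto
  from gauss_jordan_single[OF A this]
  obtain P Q where C: "C = P * A" and inv: "P * Q = 1\<^sub>m nr" "Q * P = 1\<^sub>m nr"
    and P: "P \<in> carrier_mat nr nr" and Q: "Q \<in> carrier_mat nr nr"
    and cC: "C \<in> carrier_mat nr nc" and ref: "row_echelon_form C"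
    by auto
  have "row C i \<noteq> 0\<^sub>v nc" if i: "i < nr" for i
  proof
    assume 0: "row C i = 0\<^sub>v nc"
    have "A\<^sup>T *\<^sub>v row P i = 0\<^sub>v nc"
    proof (rule eq_vecI)
      fix j assume j: "j < dim_vec (0\<^sub>v nc :: 'a vec)"
      have "(A\<^sup>T *\<^sub>v row P i) $ j = col A j \<bullet> row P i"
        using A j by simp
      also have "\<dots> = row P i \<bullet> col A j"
        by (rule comm_scalar_prod[of _ nr]) (use A P i in auto)
      also have "\<dots> = row C i $ j" using A P C i j by simp
      finally show "(A\<^sup>T *\<^sub>v row P i) $ j = 0\<^sub>v nc $ j" using 0 by simp
    qed (use A in simp)
    then have "row P i = 0\<^sub>v nr" using indep P i by auto
    then have "(P * Q) $$ (i, i) = 0" using P Q i by simp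
    then show False using inv i by simp
  qed
  then have "{i. i < nr \<and> row C i \<noteq> 0\<^sub>v nc} = {..<nr}" by auto
  moreover have "mat_kernel C = mat_kernel A"
    unfolding C by (rule mat_kernel_mult_eq[OF A P Q inv(2)])
  ultimately show ?thesis using find_base_vectors(6)[OF ref cC] by simp
qed

text \<open>The row with index \<open>r\<close> is a combination of the other rows, so deleting it does not change the
  kernel, and the remaining rows are linearly independent.\<close>

lemma kernel_dim_corank_one:
  fixes A :: "'a::field mat"
  assumes A: "A \<in> carrier_mat (Suc r) nc"
    and c: "c \<in> carrier_vec (Suc r)" "A\<^sup>T *\<^sub>v c = 0\<^sub>v nc" "c $ r \<noteq> 0"
    and uniq: "\<And>f. f \<in> carrier_vec (Suc r) \<Longrightarrow> A\<^sup>T *\<^sub>v f = 0\<^sub>v nc \<Longrightarrow> f $ r = 0 \<Longrightarrow> f = 0\<^sub>v (Suc r)"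
  shows "kernel.dim nc A = nc - r"
proof -
  define B where "B = mat r nc (\<lambda>(i, j). A $$ (i, j))"
  have B: "B \<in> carrier_mat r nc" by (simp add: B_def)
  have transp: "(A\<^sup>T *\<^sub>v f) $ j = (\<Sum>i<Suc r. A $$ (i, j) * f $ i)"
    if "f \<in> carrier_vec (Suc r)" "j < nc" for f j
    using that A by (auto simp: scalar_prod_def atLeast0LessThan intro!: sum.cong)
  have mult: "(A *\<^sub>v v) $ i = (\<Sum>j<nc. A $$ (i, j) * v $ j)"
    if "v \<in> carrier_vec nc" "i < Suc r" for v i
    using that A by (auto simp: scalar_prod_def atLeast0LessThan intro!: sum.cong)
  have multB: "(B *\<^sub>v v) $ i = (A *\<^sub>v v) $ i" if "v \<in> carrier_vec nc" "i < r" for v i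
    using that A mult[of v i] by (auto simp: B_def scalar_prod_def atLeast0LessThan intro!: sum.cong)
  have "kernel.dim nc B = nc - r"
  proof (rule kernel_dim_full_row_rank[OF B])
    fix f :: "'a vec" assume f: "f \<in> carrier_vec r" "B\<^sup>T *\<^sub>v f = 0\<^sub>v nc"
    \<comment> \<open>Padding \<open>f\<close> with 0 at index \<open>r\<close> makes a relation
      among the rows of \<open>B\<close> into one among the rows of \<open>A\<close>, to which
      \<open>uniq\<close> applies.\<close>
    define g where "g = vec (Suc r) (\<lambda>i. if i < r then f $ i else 0)"
    have g: "g \<in> carrier_vec (Suc r)" by (simp add: g_def)
    have "A\<^sup>T *\<^sub>v g = 0\<^sub>v nc"
    proof (rule eq_vecI)
      fix j assume j: "j < dim_vec (0\<^sub>v nc :: 'a vec)"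
      have "(A\<^sup>T *\<^sub>v g) $ j = (\<Sum>i<r. A $$ (i, j) * f $ i)"
        using transp[OF g, of j] j by (simp add: g_def)
      also have "\<dots> = (B\<^sup>T *\<^sub>v f) $ j"
        using f(1) j by (auto simp: B_def scalar_prod_def atLeast0LessThan intro!: sum.cong)
      finally show "(A\<^sup>T *\<^sub>v g) $ j = 0\<^sub>v nc $ j" using f by simp
    qed (use A in simp)
    then have "g = 0\<^sub>v (Suc r)" using uniq[OF g] by (simp add: g_def)
    then have "g $ i = 0" if "i < r" for i using that by simp
    then have "f $ i = 0" if "i < r" for i using that by (simp add: g_def)
    then show "f = 0\<^sub>v r" using f(1) by auto
  qed
  moreover have "mat_kernel B = mat_kernel A"
  proof (intro equalityI subsetI)
    fix v assume "v \<in> mat_kernel A"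
    then have v: "v \<in> carrier_vec nc" "A *\<^sub>v v = 0\<^sub>v (Suc r)" using mat_kernelD[OF A] by auto
    show "v \<in> mat_kernel B"
      by (rule mat_kernelI[OF B v(1)], rule eq_vecI) (use B v multB in auto)
  next
    fix v assume "v \<in> mat_kernel B"
    then have v: "v \<in> carrier_vec nc" "B *\<^sub>v v = 0\<^sub>v r" using mat_kernelD[OF B] by auto
    have 0: "(A *\<^sub>v v) $ i = 0" if "i < r" for i using multB[OF v(1) that] v(2) that by simp
    \<comment> \<open>The coordinate \<open>r\<close> of \<open>A *\<^sub>v v\<close> is recovered
      by pairing with \<open>c\<close>: the pairing equals that of
      \<open>A\<^sup>T *\<^sub>v c = 0\<close> with \<open>v\<close>, and only its term at
      \<open>r\<close> survives.\<close>
    have "c $ r * (A *\<^sub>v v) $ r = (\<Sum>i<Suc r. c $ i * (A *\<^sub>v v) $ i)" using 0 by simp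
    also have "\<dots> = (\<Sum>i<Suc r. \<Sum>j<nc. A $$ (i, j) * c $ i * v $ j)"
      by (intro sum.cong) (auto simp: mult[OF v(1)] sum_distrib_left mult_ac simp del: index_mult_mat_vec sum.lessThan_Suc)
    also have "\<dots> = (\<Sum>j<nc. (A\<^sup>T *\<^sub>v c) $ j * v $ j)"
      by (subst sum.swap, intro sum.cong)
        (auto simp: transp[OF c(1)] sum_distrib_right sum_distrib_left mult_ac simp del: index_mult_mat_vec sum.lessThan_Suc)
    also have "\<dots> = 0" using c(2) by simp
    finally have "(A *\<^sub>v v) $ r = 0" using c(3) by simp
    with 0 have "A *\<^sub>v v = 0\<^sub>v (Suc r)"
      using A by (intro eq_vecI) (auto simp: less_Suc_eq simp del: index_mult_mat_vec)
    with A v(1) show "v \<in> mat_kernel A" by (rule mat_kernelI)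
  qed
  ultimately show ?thesis by simp
qed

lemma mat_kernel_subspace:
  fixes A :: "'a::field mat"
  assumes "A \<in> carrier_mat nr nc"
  shows "VectorSpace.subspace class_ring (mat_kernel A) (module_vec TYPE('a) nc)"
proof -
  interpret kernel nr nc A by unfold_locales fact
  have "submodule class_ring (mat_kernel A) NC.V"
    by unfold_locales
      (insert A mult_add_distrib_mat_vec[OF A] mult_mat_vec[OF A] mat_kernel[OF A],
        auto simp: class_ring_simps)
  then show ?thesis using NC.vectorspace_axioms by (simp add: VectorSpace.subspace_def)
qed

text \<open>Orthogonality to a span only has to be tested on the generators, here the rows, and
  testing all rows is one matrix-vector product.\<close>

lemma dual_code_of:
  "dual_code (dim_col H) (code_of H) = mat_kernel (map_mat of_int H)"
proof -
  interpret vec_space "TYPE('a)" "dim_col H" .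
  let ?A = "map_mat of_int H :: 'a mat"
  have rows: "set (rows ?A) \<subseteq> carrier_vec (dim_col H)"
    using rows_carrier[of ?A] by simp
  have "orthogonal_complement (row_space ?A) = orthogonal_complement (set (rows ?A))"
    unfolding row_space_def by (rule in_orthogonal_complement_span[OF rows])
  also have "\<dots> = mat_kernel ?A"
  proof -
    have "(\<forall>y\<in>set (rows ?A). x \<bullet> y = 0) \<longleftrightarrow> ?A *\<^sub>v x = 0\<^sub>v (dim_row H)"
      if x: "x \<in> carrier_vec (dim_col H)" for x
    proof -
      have "(\<forall>y\<in>set (rows ?A). x \<bullet> y = 0) \<longleftrightarrow> (\<forall>i<dim_row H. row ?A i \<bullet> x = 0)"
        using x rows by (auto simp: rows_def comm_scalar_prod[of x "dim_col H"])
      also have "\<dots> \<longleftrightarrow> ?A *\<^sub>v x = 0\<^sub>v (dim_row H)"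
        by (auto simp: vec_eq_iff)
      finally show ?thesis .
    qed
    then show ?thesis by (auto simp: orthogonal_complement_def mat_kernel_def)
  qed
  finally show ?thesis by (simp add: code_of_def)
qed

section \<open>Incidence matrices: relations among the rows, kernels, dual codes\<close>

text \<open>The entry type is left open so that one expression serves for the integer matrix and for
  its image over the field.\<close>

definition incidence_mat :: "'v list \<Rightarrow> 'v set list \<Rightarrow> 'a::zero_neq_one mat" where
  "incidence_mat vs es = mat (length vs) (length es) (\<lambda>(i, j). if vs ! i \<in> es ! j then 1 else 0)"

lemma incidence_mat_carrier [simp]:
  "incidence_mat vs es \<in> carrier_mat (length vs) (length es)"
  by (simp add: incidence_mat_def)

lemma dim_col_incidence_mat [simp]: "dim_col (incidence_mat vs es) = length es"
  by (simp add: incidence_mat_def)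

lemma map_mat_incidence_mat:
  "map_mat of_int (incidence_mat vs es :: int mat) = (incidence_mat vs es :: 'a::field mat)"
  by (rule eq_matI) (auto simp: incidence_mat_def)

lemma sum_nth_distinct: "distinct xs \<Longrightarrow> (\<Sum>i<length xs. g (xs ! i)) = sum g (set xs)"
  by (simp add: sum.distinct_set_conv_list sum_list_sum_nth atLeast0LessThan)

text \<open>Row \<open>i\<close> of the product adds up the weights of the edges at
  \<open>vs ! i\<close>. From here on a codeword is a weight function on edges whose sum at every
  vertex is 0, independent of the enumerations.\<close>

lemma incidence_mat_kernel_iff:
  fixes w :: "'v set \<Rightarrow> 'a::field"
  assumes "distinct es"
  shows "vec (length es) (\<lambda>j. w (es ! j)) \<in> mat_kernel (incidence_mat vs es) \<longleftrightarrow>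
    (\<forall>x\<in>set vs. (\<Sum>e\<in>{e\<in>set es. x \<in> e}. w e) = 0)" (is "?v \<in> _ \<longleftrightarrow> _")
proof -
  have "((incidence_mat vs es :: 'a mat) *\<^sub>v ?v) $ i = (\<Sum>e\<in>{e\<in>set es. vs ! i \<in> e}. w e)"
    if i: "i < length vs" for i
  proof -
    have "((incidence_mat vs es :: 'a mat) *\<^sub>v ?v) $ i =
        (\<Sum>j<length es. (\<lambda>e. if vs ! i \<in> e then w e else 0) (es ! j))"
      using i by (auto simp: incidence_mat_def scalar_prod_def atLeast0LessThan intro!: sum.cong)
    also have "\<dots> = (\<Sum>e\<in>{e\<in>set es. vs ! i \<in> e}. w e)"
      unfolding sum_nth_distinct[OF assms, of "\<lambda>e. if vs ! i \<in> e then w e else 0"]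
      by (simp add: sum.inter_filter)
    finally show ?thesis .
  qed
  then have "(incidence_mat vs es :: 'a mat) *\<^sub>v ?v = 0\<^sub>v (length vs) \<longleftrightarrow>
      (\<forall>i<length vs. (\<Sum>e\<in>{e\<in>set es. vs ! i \<in> e}. w e) = 0)"
    by (auto simp: vec_eq_iff incidence_mat_def simp del: index_mult_mat_vec)
  then show ?thesis
    by (auto simp: mat_kernel[OF incidence_mat_carrier] all_set_conv_all_nth)
qed

text \<open>In a distinct list an element determines its index, so coordinates can be read as values
  of a function on the elements.\<close>

lemma vec_on_list:
  assumes "distinct xs" "v \<in> carrier_vec (length xs)"
  obtains w where "v = vec (length xs) (\<lambda>j. w (xs ! j))"
proof
  show "v = vec (length xs) (\<lambda>j. v $ (THE i. i < length xs \<and> xs ! i = xs ! j))"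
  proof (rule eq_vecI)
    fix j assume "j < dim_vec (vec (length xs) (\<lambda>j. v $ (THE i. i < length xs \<and> xs ! i = xs ! j)))"
    then have "j < length xs" by simp
    moreover from this have "(THE i. i < length xs \<and> xs ! i = xs ! j) = j"
      using assms(1) by (intro the_equality) (auto simp: nth_eq_iff_index_eq)
    ultimately show "v $ j = vec (length xs) (\<lambda>j. v $ (THE i. i < length xs \<and> xs ! i = xs ! j)) $ j"
      by simp
  qed (use assms in auto)
qed

lemma hamming_weight_on_list:
  assumes "distinct xs"
  shows "hamming_weight (vec (length xs) (\<lambda>j. w (xs ! j))) = card {x \<in> set xs. w x \<noteq> 0}"
proof -
  have "bij_betw ((!) xs) {i. i < length xs \<and> w (xs ! i) \<noteq> 0} {x \<in> set xs. w x \<noteq> 0}"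
    using assms by (auto simp: bij_betw_def inj_on_def nth_eq_iff_index_eq in_set_conv_nth image_iff)
  from bij_betw_same_card[OF this] show ?thesis
    by (simp add: hamming_weight_def cong: conj_cong)
qed

text \<open>The transposed matrix sends a vertex function \<open>g\<close> to
  \<open>g x + g y\<close> on the edge \<open>{x, y}\<close>, so the relations among the rows are
  the functions that change sign along edges. Here \<open>c\<close> is such a relation with no zero,
  and by \<open>uniq\<close> one that vanishes at the last vertex vanishes everywhere; thus the rank
  is one less than the number of vertices.\<close>

lemma incidence_mat_kernel_dim:
  fixes c :: "'v \<Rightarrow> 'a::field"
  assumes vs: "distinct vs" "vs \<noteq> []"
    and E: "\<And>e. e \<in> set es \<Longrightarrow> \<exists>x\<in>set vs. \<exists>y\<in>set vs. x \<noteq> y \<and> e = {x, y}"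
    and c: "\<And>x y. {x, y} \<in> set es \<Longrightarrow> x \<noteq> y \<Longrightarrow> c x + c y = 0" "\<And>x. x \<in> set vs \<Longrightarrow> c x \<noteq> 0"
    and uniq: "\<And>f :: 'v \<Rightarrow> 'a. \<lbrakk>\<And>x y. {x, y} \<in> set es \<Longrightarrow> x \<noteq> y \<Longrightarrow> f x + f y = 0;
      \<exists>x\<in>set vs. f x = 0\<rbrakk> \<Longrightarrow> \<forall>x\<in>set vs. f x = 0"
  shows "kernel.dim (length es) (incidence_mat vs es :: 'a mat) = length es - (length vs - 1)"
proof -
  let ?A = "incidence_mat vs es :: 'a mat"
  obtain r where r: "length vs = Suc r" using vs(2) by (cases vs) auto
  have A: "?A \<in> carrier_mat (Suc r) (length es)" by (simp flip: r)
  have transp: "(?A\<^sup>T *\<^sub>v vec (Suc r) (\<lambda>i. g (vs ! i))) $ j = g x + g y"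
    if "j < length es" "es ! j = {x, y}" "x \<in> set vs" "y \<in> set vs" "x \<noteq> y" for g :: "'v \<Rightarrow> 'a" and x y j
  proof -
    have "(?A\<^sup>T *\<^sub>v vec (Suc r) (\<lambda>i. g (vs ! i))) $ j =
        (\<Sum>i<length vs. (\<lambda>z. if z \<in> {x, y} then g z else 0) (vs ! i))"
      using that unfolding r[symmetric]
      by (auto simp: incidence_mat_def scalar_prod_def atLeast0LessThan intro!: sum.cong)
    also have "\<dots> = (\<Sum>z\<in>set vs. if z \<in> {x, y} then g z else 0)"
      by (rule sum_nth_distinct[OF vs(1)])
    also have "\<dots> = sum g (set vs \<inter> {x, y})" by (simp add: sum.inter_restrict)
    also have "set vs \<inter> {x, y} = {x, y}" using that by auto
    finally show ?thesis using that by simp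
  qed
  have "kernel.dim (length es) ?A = length es - r"
  proof (rule kernel_dim_corank_one[OF A])
    show "vec (Suc r) (\<lambda>i. c (vs ! i)) \<in> carrier_vec (Suc r)" by simp
    show "?A\<^sup>T *\<^sub>v vec (Suc r) (\<lambda>i. c (vs ! i)) = 0\<^sub>v (length es)"
    proof (rule eq_vecI)
      fix j assume j: "j < dim_vec (0\<^sub>v (length es) :: 'a vec)"
      then have e: "es ! j \<in> set es" by simp
      from E[OF this] obtain x y where xy: "x \<in> set vs" "y \<in> set vs" "x \<noteq> y" "es ! j = {x, y}" by auto
      from transp[OF _ xy(4,1,2,3), of c] c(1)[of x y] xy e j
      show "(?A\<^sup>T *\<^sub>v vec (Suc r) (\<lambda>i. c (vs ! i))) $ j = 0\<^sub>v (length es) $ j" by simp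
    qed simp
    show "vec (Suc r) (\<lambda>i. c (vs ! i)) $ r \<noteq> 0" using c(2) r by simp
  next
    fix v :: "'a vec" assume v: "v \<in> carrier_vec (Suc r)" "?A\<^sup>T *\<^sub>v v = 0\<^sub>v (length es)" "v $ r = 0"
    obtain f where f: "v = vec (Suc r) (\<lambda>i. f (vs ! i))"
      using vec_on_list[OF vs(1), of v] v(1) r by metis
    have "f x + f y = 0" if xy: "{x, y} \<in> set es" "x \<noteq> y" for x y
    proof -
      obtain j where j: "j < length es" "es ! j = {x, y}" using xy by (metis in_set_conv_nth)
      have "x \<in> set vs" "y \<in> set vs" using E[OF xy(1)] by (auto simp: doubleton_eq_iff)
      from transp[OF j this xy(2), of f] v(2) f j show ?thesis
        by (simp del: index_mult_mat_vec)
    qed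
    moreover have "\<exists>x\<in>set vs. f x = 0" using v(3) f r by (intro bexI[of _ "vs ! r"]) auto
    ultimately have "\<forall>x\<in>set vs. f x = 0" by (rule uniq)
    then show "v = 0\<^sub>v (Suc r)" using f r by (auto simp: vec_eq_iff)
  qed
  then show ?thesis using r by simp
qed

text \<open>Reduces the three code parameters to graph data: \<open>c\<close> and
  \<open>uniq\<close> make the row relations a line and so fix the dimension, \<open>word\<close>
  exhibits weight \<open>d\<close>, and \<open>dist\<close> is the lower bound.\<close>

lemma is_code_dual_incidence:
  fixes c :: "'v \<Rightarrow> 'a::field" and w :: "'v set \<Rightarrow> 'a"
  assumes H: "is_incidence_matrix H (V, E)" and V: "V \<noteq> {}"
    and E: "\<And>e. e \<in> E \<Longrightarrow> \<exists>x\<in>V. \<exists>y\<in>V. x \<noteq> y \<and> e = {x, y}"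
    and c: "\<And>x y. {x, y} \<in> E \<Longrightarrow> x \<noteq> y \<Longrightarrow> c x + c y = 0" "\<And>x. x \<in> V \<Longrightarrow> c x \<noteq> 0"
    and uniq: "\<And>f :: 'v \<Rightarrow> 'a. \<lbrakk>\<And>x y. {x, y} \<in> E \<Longrightarrow> x \<noteq> y \<Longrightarrow> f x + f y = 0;
      \<exists>x\<in>V. f x = 0\<rbrakk> \<Longrightarrow> \<forall>x\<in>V. f x = 0"
    and d: "0 < d"
    and word: "\<And>x. x \<in> V \<Longrightarrow> (\<Sum>e\<in>{e\<in>E. x \<in> e}. w e) = 0"
      "card {e\<in>E. w e \<noteq> 0} = d"
    and dist: "\<And>u :: 'v set \<Rightarrow> 'a. (\<And>x. x \<in> V \<Longrightarrow> (\<Sum>e\<in>{e\<in>E. x \<in> e}. u e) = 0) \<Longrightarrow>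
      \<exists>e\<in>E. u e \<noteq> 0 \<Longrightarrow> d \<le> card {e\<in>E. u e \<noteq> 0}"
  shows "is_code CARD('a) (card E) (card E - (card V - 1)) d
    (dual_code (dim_col H) (code_of H :: 'a vec set))"
proof -
  obtain vs es where vs: "distinct vs" "set vs = V" and es: "distinct es" "set es = E"
    and H': "H = incidence_mat vs es"
    using H by (auto simp: is_incidence_matrix_def incidence_mat_def)
  let ?A = "incidence_mat vs es :: 'a mat"
  have dual: "dual_code (dim_col H) (code_of H :: 'a vec set) = mat_kernel ?A"
    unfolding dual_code_of by (simp add: H' map_mat_incidence_mat)
  have card: "length es = card E" "length vs = card V"
    using vs es distinct_card by fastforce+
  note kernel_iff = incidence_mat_kernel_iff[OF es(1), of _ vs, unfolded vs es]
  note weight = hamming_weight_on_list[OF es(1), unfolded es]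
  have "VectorSpace.subspace class_ring (mat_kernel ?A) (module_vec TYPE('a) (card E))"
    unfolding card(1)[symmetric] by (rule mat_kernel_subspace[OF incidence_mat_carrier])
  moreover have "kernel.dim (card E) ?A = card E - (card V - 1)"
    unfolding card[symmetric]
  proof (rule incidence_mat_kernel_dim[OF vs(1), where c = c])
    show "vs \<noteq> []" using V vs(2) by auto
    show "\<forall>x\<in>set vs. f x = 0"
      if "\<And>x y. {x, y} \<in> set es \<Longrightarrow> x \<noteq> y \<Longrightarrow> f x + f y = 0" "\<exists>x\<in>set vs. f x = 0" for f :: "'v \<Rightarrow> 'a"
      using uniq[of f] that unfolding vs es by blast
  qed (use E c vs es in auto)
  moreover have "\<exists>v\<in>mat_kernel ?A. v \<noteq> 0\<^sub>v (card E) \<and> hamming_weight v = d"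
  proof
    let ?v = "vec (length es) (\<lambda>j. w (es ! j))"
    show "?v \<in> mat_kernel ?A" using kernel_iff word(1) by blast
    have "hamming_weight ?v = d" using weight[of w] word(2) by simp
    moreover have "hamming_weight (0\<^sub>v (card E) :: 'a vec) = 0"
      by (simp add: hamming_weight_def)
    ultimately show "?v \<noteq> 0\<^sub>v (card E) \<and> hamming_weight ?v = d" using d by auto
  qed
  moreover have "\<forall>v\<in>mat_kernel ?A. v \<noteq> 0\<^sub>v (card E) \<longrightarrow> d \<le> hamming_weight v"
  proof (intro ballI impI)
    fix v assume v: "v \<in> mat_kernel ?A" "v \<noteq> 0\<^sub>v (card E)"
    then have "v \<in> carrier_vec (length es)" using mat_kernelD(1)[OF incidence_mat_carrier] by blast
    then obtain u where u: "v = vec (length es) (\<lambda>j. u (es ! j))" by (rule vec_on_list[OF es(1)])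
    obtain j where "j < length es" "u (es ! j) \<noteq> 0" using v(2) u card by (auto simp: vec_eq_iff)
    then have "\<exists>e\<in>E. u e \<noteq> 0" using es(2) by auto
    then show "d \<le> hamming_weight v"
      unfolding u weight[of u] using dist v(1) kernel_iff u by blast
  qed
  ultimately show ?thesis unfolding dual is_code_def by simp
qed

section \<open>Supports of codewords, and words carried by short cycles\<close>

text \<open>Start from an edge \<open>{a, b}\<close> and extend it by a further neighbour
  \<open>c\<close> of \<open>a\<close> and \<open>d\<close> of \<open>b\<close>. If
  \<open>c = d\<close>, this is a triangle. Otherwise \<open>c\<close> has a neighbour
  \<open>z\<close> other than \<open>a\<close>, and \<open>{a, b}\<close>, \<open>{a, c}\<close>,
  \<open>{b, d}\<close>, \<open>{c, z}\<close> are distinct, even if \<open>z\<close> is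
  \<open>b\<close> or \<open>d\<close>.\<close>

lemma min_degree_two_triangle_or_four_edges:
  assumes fin: "finite S" and edges: "\<And>e. e \<in> S \<Longrightarrow> \<exists>x y. x \<noteq> y \<and> e = {x, y}"
    and nonempty: "S \<noteq> {}"
    and deg: "\<And>e x. e \<in> S \<Longrightarrow> x \<in> e \<Longrightarrow> \<exists>e'\<in>S. e' \<noteq> e \<and> x \<in> e'"
  shows "(\<exists>a b c. a \<noteq> b \<and> b \<noteq> c \<and> a \<noteq> c \<and> {a, b} \<in> S \<and> {b, c} \<in> S \<and> {a, c} \<in> S) \<or> 4 \<le> card S"
proof -
  obtain a b where ab: "a \<noteq> b" "{a, b} \<in> S" using nonempty edges by blast
  have nbr: "\<exists>z. z \<noteq> x \<and> z \<noteq> y \<and> {y, z} \<in> S" if xy: "x \<noteq> y" "{x, y} \<in> S" for x y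
  proof -
    obtain e where e: "e \<in> S" "e \<noteq> {x, y}" "y \<in> e" using deg[OF xy(2), of y] by auto
    from edges[OF e(1)] obtain s t where "s \<noteq> t" "e = {s, t}" by auto
    with e xy show ?thesis by (auto simp: insert_commute)
  qed
  obtain c where c: "c \<noteq> a" "c \<noteq> b" "{a, c} \<in> S" using nbr[of b a] ab by (auto simp: insert_commute)
  obtain d where d: "d \<noteq> a" "d \<noteq> b" "{b, d} \<in> S" using nbr[of a b] ab by auto
  show ?thesis
  proof (cases "c = d")
    case True
    then show ?thesis using ab c d by (intro disjI1 exI[of _ a] exI[of _ b] exI[of _ c]) auto
  next
    case False
    obtain z where z: "z \<noteq> a" "z \<noteq> c" "{c, z} \<in> S" using nbr[of a c] c by auto
    have "card {{a, b}, {a, c}, {b, d}, {c, z}} = 4"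
      using ab c d z False by (simp add: doubleton_eq_iff card_insert_if)
    moreover have "card {{a, b}, {a, c}, {b, d}, {c, z}} \<le> card S"
      using ab c d z by (intro card_mono[OF fin]) auto
    ultimately show ?thesis by simp
  qed
qed

text \<open>If only one edge of the support met a vertex, the sum there would be its nonzero weight;
  hence the previous lemma applies to the support. The first conclusion leaves the triangle as an
  alternative so that it can be excluded in a bipartite graph.\<close>

lemma balanced_support:
  fixes w :: "'v set \<Rightarrow> 'a::field"
  assumes fin: "finite E" and edges: "\<And>e. e \<in> E \<Longrightarrow> \<exists>x\<in>V. \<exists>y\<in>V. x \<noteq> y \<and> e = {x, y}"
    and bal: "\<And>x. x \<in> V \<Longrightarrow> (\<Sum>e\<in>{e\<in>E. x \<in> e}. w e) = 0"
    and nz: "\<exists>e\<in>E. w e \<noteq> 0"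
  shows "(\<exists>a b c. a \<noteq> b \<and> b \<noteq> c \<and> a \<noteq> c \<and> {a, b} \<in> E \<and> {b, c} \<in> E \<and> {a, c} \<in> E) \<or>
      4 \<le> card {e\<in>E. w e \<noteq> 0}"
    and "3 \<le> card {e\<in>E. w e \<noteq> 0}"
proof -
  let ?S = "{e\<in>E. w e \<noteq> 0}"
  have S: "finite ?S" using fin by simp
  have "\<exists>e'\<in>?S. e' \<noteq> e \<and> x \<in> e'" if e: "e \<in> ?S" "x \<in> e" for e x
  proof (rule ccontr)
    assume "\<not> ?thesis"
    then have "(\<Sum>e'\<in>{e\<in>E. x \<in> e} - {e}. w e') = 0" by (intro sum.neutral) auto
    moreover have "(\<Sum>e\<in>{e\<in>E. x \<in> e}. w e) = w e + (\<Sum>e'\<in>{e\<in>E. x \<in> e} - {e}. w e')"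
      using fin e by (intro sum.remove) auto
    moreover have "x \<in> V" using edges[of e] e by auto
    ultimately show False using bal e by auto
  qed
  then have *: "(\<exists>a b c. a \<noteq> b \<and> b \<noteq> c \<and> a \<noteq> c \<and> {a, b} \<in> ?S \<and> {b, c} \<in> ?S \<and> {a, c} \<in> ?S) \<or>
      4 \<le> card ?S"
    by (intro min_degree_two_triangle_or_four_edges[OF S]) (use edges nz in blast)+
  then show "(\<exists>a b c. a \<noteq> b \<and> b \<noteq> c \<and> a \<noteq> c \<and> {a, b} \<in> E \<and> {b, c} \<in> E \<and> {a, c} \<in> E) \<or>
      4 \<le> card ?S" by blast
  from * show "3 \<le> card ?S"
  proof (elim disjE exE conjE)
    fix a b c assume abc: "a \<noteq> b" "b \<noteq> c" "a \<noteq> c" "{a, b} \<in> ?S" "{b, c} \<in> ?S" "{a, c} \<in> ?S"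
    then have "card {{a, b}, {b, c}, {a, c}} = 3"
      by (simp add: doubleton_eq_iff card_insert_if)
    moreover have "card {{a, b}, {b, c}, {a, c}} \<le> card ?S"
      using abc by (intro card_mono[OF S]) auto
    ultimately show ?thesis by simp
  qed simp
qed

lemma sum_incident_supported:
  fixes w :: "'v set \<Rightarrow> 'a::comm_monoid_add"
  assumes "finite E" "C \<subseteq> E" "\<And>e. e \<notin> C \<Longrightarrow> w e = 0"
  shows "(\<Sum>e\<in>{e\<in>E. x \<in> e}. w e) = (\<Sum>e\<in>C. if x \<in> e then w e else 0)"
proof -
  have "(\<Sum>e\<in>{e\<in>E. x \<in> e}. w e) = (\<Sum>e\<in>E. if x \<in> e then w e else 0)"
    using assms(1) by (rule sum.inter_filter)
  also have "\<dots> = (\<Sum>e\<in>C. if x \<in> e then w e else 0)"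
    using assms by (intro sum.mono_neutral_right) auto
  finally show ?thesis .
qed

text \<open>Put weight 1 on the three edges: each vertex of the triangle meets two of them, and
  \<open>1 + 1 = 0\<close>.\<close>

lemma triangle_word:
  assumes "finite E" and char_two: "(1 :: 'a::field) + 1 = 0"
    and abc: "a \<noteq> b" "b \<noteq> c" "a \<noteq> c" "{a, b} \<in> E" "{b, c} \<in> E" "{a, c} \<in> E"
  obtains w :: "'v set \<Rightarrow> 'a::field"
  where "\<And>x. (\<Sum>e\<in>{e\<in>E. x \<in> e}. w e) = 0" "card {e\<in>E. w e \<noteq> 0} = 3"
proof
  let ?C = "{{a, b}, {b, c}, {a, c}}"
  define w :: "'v set \<Rightarrow> 'a" where "w = (\<lambda>e. if e \<in> ?C then 1 else 0)"
  have C: "?C \<subseteq> E" using abc by auto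
  have "(\<Sum>e\<in>{e\<in>E. x \<in> e}. w e) = (\<Sum>e\<in>?C. if x \<in> e then w e else 0)" for x
    by (rule sum_incident_supported[OF assms(1) C]) (simp add: w_def)
  also have "\<dots> x = 0" for x
    using abc char_two by (cases "x = a"; cases "x = b"; cases "x = c")
      (simp_all add: w_def doubleton_eq_iff)
  finally show "(\<Sum>e\<in>{e\<in>E. x \<in> e}. w e) = 0" for x .
  have "{e\<in>E. w e \<noteq> 0} = ?C" using C by (auto simp: w_def)
  then show "card {e\<in>E. w e \<noteq> 0} = 3"
    using abc by (simp add: doubleton_eq_iff card_insert_if)
qed

text \<open>Alternate the weights 1 and -1 around the cycle, so that each of its vertices meets one
  edge of either sign.\<close>

lemma four_cycle_word:
  assumes "finite E"
    and abcd: "distinct [a, b, c, d]" "{a, b} \<in> E" "{b, c} \<in> E" "{c, d} \<in> E" "{d, a} \<in> E"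
  obtains w :: "'v set \<Rightarrow> 'a::field"
  where "\<And>x. (\<Sum>e\<in>{e\<in>E. x \<in> e}. w e) = 0" "card {e\<in>E. w e \<noteq> 0} = 4"
proof
  let ?C = "{{a, b}, {b, c}, {c, d}, {d, a}}"
  define w :: "'v set \<Rightarrow> 'a" where
    "w = (\<lambda>e. if e \<in> {{a, b}, {c, d}} then 1 else if e \<in> {{b, c}, {d, a}} then -1 else 0)"
  have C: "?C \<subseteq> E" using abcd by auto
  have ne: "a \<noteq> b" "a \<noteq> c" "a \<noteq> d" "b \<noteq> c" "b \<noteq> d" "c \<noteq> d"
    "b \<noteq> a" "c \<noteq> a" "d \<noteq> a" "c \<noteq> b" "d \<noteq> b" "d \<noteq> c"
    using abcd by auto
  have "(\<Sum>e\<in>{e\<in>E. x \<in> e}. w e) = (\<Sum>e\<in>?C. if x \<in> e then w e else 0)" for x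
    by (rule sum_incident_supported[OF assms(1) C]) (simp add: w_def)
  also have "\<dots> x = 0" for x
    by (cases "x = a"; cases "x = b"; cases "x = c"; cases "x = d")
      (simp_all add: w_def doubleton_eq_iff ne)
  finally show "(\<Sum>e\<in>{e\<in>E. x \<in> e}. w e) = 0" for x .
  have "{e\<in>E. w e \<noteq> 0} = ?C" using C by (auto simp: w_def)
  then show "card {e\<in>E. w e \<noteq> 0} = 4"
    by (simp add: doubleton_eq_iff card_insert_if ne)
qed

section \<open>Edges of the unit graph, and functions that change sign along them\<close>

text \<open>Every fibre of the map from \<open>(x, y)\<close> to \<open>{x, y}\<close> on
  \<open>P\<close> consists of two pairs, by symmetry and irreflexivity.\<close>

lemma two_card_doubletons:
  assumes fin: "finite P" and sym: "\<And>x y. (x, y) \<in> P \<Longrightarrow> (y, x) \<in> P"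
    and irrefl: "\<And>x. (x, x) \<notin> P"
  shows "2 * card {{x, y} | x y. (x, y) \<in> P} = card P"
proof -
  let ?g = "\<lambda>p. {fst p, snd p}"
  have E: "{{x, y} | x y. (x, y) \<in> P} = ?g ` P" by force
  have "card {p \<in> P. ?g p = e} = 2" if "e \<in> ?g ` P" for e
  proof -
    obtain x y where xy: "(x, y) \<in> P" "e = {x, y}" using \<open>e \<in> ?g ` P\<close> by auto
    then have "{p \<in> P. ?g p = e} = {(x, y), (y, x)}"
      using sym by (auto simp: doubleton_eq_iff)
    moreover have "x \<noteq> y" using irrefl xy by auto
    ultimately show ?thesis by simp
  qed
  then have "(\<Sum>e\<in>?g ` P. card {p \<in> P. ?g p = e}) = card (?g ` P) * 2" by simp
  moreover have "card P = (\<Sum>e\<in>?g ` P. card {p \<in> P. ?g p = e})"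
    using sum.image_gen[OF fin, of "\<lambda>_. 1 :: nat" ?g] by simp
  ultimately show ?thesis unfolding E by simp
qed

lemma Units_residue_ring:
  assumes "1 < n"
  shows "Units (residue_ring n) = {x \<in> {0..<n}. coprime x n}"
proof -
  interpret residues n "residue_ring n" using assms by unfold_locales auto
  show ?thesis unfolding res_units_eq using assms by (auto simp: order_le_less)
qed

lemma card_Units_residue_ring:
  assumes "1 < n"
  shows "card {x \<in> {0..<n}. coprime x n} = totient (nat n)"
proof -
  interpret residues n "residue_ring n" using assms by unfold_locales auto
  show ?thesis using totient_eq Units_residue_ring[OF assms] by simp
qed

lemma coprime_mod_left: "coprime (a mod n) n \<longleftrightarrow> coprime a (n :: int)"
  by (metis gcd_mod_left coprime_iff_gcd_eq_1 gcd.commute gcd_red_int)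

text \<open>Sums are taken in the integers: coprimality to \<open>n\<close> depends only on the
  residue, so no reduction is required.\<close>

definition unit_edges :: "int \<Rightarrow> int set set" where
  "unit_edges n = {{x, y} | x y. x \<in> {0..<n} \<and> y \<in> {0..<n} \<and> x \<noteq> y \<and> coprime (x + y) n}"

lemma unit_graph_residue_ring:
  assumes "1 < n"
  shows "unit_graph (residue_ring n) = ({0..<n}, unit_edges n)"
proof -
  have "(x + y) mod n \<in> Units (residue_ring n) \<longleftrightarrow> coprime (x + y) n" for x y
    unfolding Units_residue_ring[OF assms] using assms by (simp add: coprime_mod_left)
  moreover have "carrier (residue_ring n) = {0..<n}" "add (residue_ring n) = (\<lambda>x y. (x + y) mod n)"
    by (auto simp: residue_ring_def)
  ultimately show ?thesis by (simp add: unit_graph_def unit_edges_def)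
qed

lemma unit_edges_iff:
  "{x, y} \<in> unit_edges n \<longleftrightarrow> x \<in> {0..<n} \<and> y \<in> {0..<n} \<and> x \<noteq> y \<and> coprime (x + y) n"
  by (auto simp: unit_edges_def doubleton_eq_iff add.commute)

lemma unit_edges_doubleton:
  assumes "e \<in> unit_edges n"
  shows "\<exists>x\<in>{0..<n}. \<exists>y\<in>{0..<n}. x \<noteq> y \<and> e = {x, y}"
  using assms unfolding unit_edges_def by blast

lemma finite_unit_edges: "finite (unit_edges n)"
  by (rule finite_subset[of _ "Pow {0..<n}"]) (auto simp: unit_edges_def)

text \<open>For fixed \<open>x\<close>, translation by \<open>x\<close> modulo \<open>n\<close> is a
  bijection onto the units, so each \<open>x\<close> contributes the totient.\<close>

lemma card_unit_sums:
  assumes n: "1 < n"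
  shows "card {(x, y) \<in> {0..<n} \<times> {0..<n}. coprime (x + y) n} = nat n * totient (nat n)"
proof -
  have "card {y \<in> {0..<n}. coprime (x + y) n} = totient (nat n)" for x
  proof -
    have "bij_betw (\<lambda>y. (x + y) mod n) {y \<in> {0..<n}. coprime (x + y) n} {z \<in> {0..<n}. coprime z n}"
    proof (rule bij_betw_byWitness[where f' = "\<lambda>z. (z - x) mod n"])
      have "coprime (x + (z - x) mod n) n \<longleftrightarrow> coprime z n" for z
        using coprime_mod_left[of "x + (z - x) mod n" n] by (simp add: mod_simps coprime_mod_left)
      then show "(\<lambda>z. (z - x) mod n) ` {z \<in> {0..<n}. coprime z n} \<subseteq> {y \<in> {0..<n}. coprime (x + y) n}"
        using n by auto
    qed (use n in \<open>auto simp: mod_simps coprime_mod_left\<close>)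
    from bij_betw_same_card[OF this] show ?thesis using card_Units_residue_ring[OF n] by simp
  qed
  moreover have "{(x, y) \<in> {0..<n} \<times> {0..<n}. coprime (x + y) n} =
      (SIGMA x:{0..<n}. {y \<in> {0..<n}. coprime (x + y) n})" by auto
  moreover have "card (SIGMA x:{0..<n}. {y \<in> {0..<n}. coprime (x + y) n}) =
      (\<Sum>x\<in>{0..<n}. card {y \<in> {0..<n}. coprime (x + y) n})"
    by (rule card_SigmaI) (auto intro: finite_subset[of _ "{0..<n}"])
  ultimately show ?thesis by simp
qed

text \<open>Ordered pairs with unit sum count each edge twice, once the diagonal is removed. A
  diagonal pair needs \<open>2 * x\<close> to be a unit, which never happens for even
  \<open>n\<close> and means that \<open>x\<close> is a unit for odd \<open>n\<close>.\<close>

lemma two_card_unit_edges: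
  assumes n: "1 < n"
  shows "2 * card (unit_edges n) = (if even n then nat n else nat n - 1) * totient (nat n)"
proof -
  let ?V = "{0..<n}"
  let ?P = "{(x, y) \<in> ?V \<times> ?V. coprime (x + y) n}" and ?D = "{x \<in> ?V. coprime (x + x) n}"
  have fin: "finite ?P" by (rule finite_subset[of _ "?V \<times> ?V"]) auto
  let ?Q = "{(x, y) \<in> ?V \<times> ?V. x \<noteq> y \<and> coprime (x + y) n}"
  have "unit_edges n = {{x, y} | x y. (x, y) \<in> ?Q}" by (simp add: unit_edges_def conj_assoc)
  moreover have "2 * card {{x, y} | x y. (x, y) \<in> ?Q} = card ?Q"
    by (rule two_card_doubletons) (use fin in \<open>auto simp: add.commute intro: finite_subset[of _ ?P]\<close>)
  moreover have "?Q = ?P - (\<lambda>x. (x, x)) ` ?D" by auto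
  ultimately have "2 * card (unit_edges n) = card (?P - (\<lambda>x. (x, x)) ` ?D)" by simp
  also have "\<dots> = card ?P - card ((\<lambda>x. (x, x)) ` ?D)"
    by (rule card_Diff_subset) (rule finite_imageI, rule finite_subset[of _ ?V], auto)
  also have "card ((\<lambda>x. (x, x)) ` ?D) = card ?D" by (rule card_image) (simp add: inj_on_def)
  also have "card ?D = (if even n then 0 else totient (nat n))"
  proof (cases "even n")
    case True
    then have "\<not> coprime (x + x) n" for x using not_coprimeI[of 2 "x + x" n] by simp
    with True show ?thesis by simp
  next
    case False
    then have "coprime (x + x) n \<longleftrightarrow> coprime x n" for x
      unfolding mult_2[symmetric] by (simp add: coprime_mult_left_iff)
    with False show ?thesis using card_Units_residue_ring[OF n] by simp
  qed
  finally show ?thesis using card_unit_sums[OF n] by (simp add: diff_mult_distrib)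
qed

text \<open>The elements \<open>1\<close> and \<open>-1\<close> are units, so \<open>x\<close>, \<open>1 - x\<close>, \<open>x - 2\<close> is a walk in the unit graph
  and \<open>f\<close> is determined by its values at \<open>0\<close> and \<open>1\<close>. The walk may use loops, which the hypothesis
  on \<open>2\<close> renders harmless: either \<open>n\<close> is even and there are none, or they impose \<open>f x + f x = 0\<close>.\<close>

lemma alternating_zero:
  fixes f :: "int \<Rightarrow> 'a::field"
  assumes n: "1 < n" and two: "(1 :: 'a) + 1 = 0 \<or> even n"
    and f: "\<And>x y. {x, y} \<in> unit_edges n \<Longrightarrow> x \<noteq> y \<Longrightarrow> f x + f y = 0"
    and zero: "\<exists>x\<in>{0..<n}. f x = 0"
  shows "\<forall>x\<in>{0..<n}. f x = 0"
proof -
  have edge: "f (x mod n) + f (y mod n) = 0" if xy: "coprime (x + y) n" for x y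
  proof (cases "x mod n = y mod n")
    case True
    have cop: "coprime (x mod n + y mod n) n"
      using xy by (metis coprime_mod_left mod_add_eq)
    then have "odd n" using True not_coprimeI[of 2 "x mod n + y mod n" n] by auto
    then have "f (x mod n) * (1 + 1) = 0" using two by auto
    then show ?thesis using True by auto
  next
    case False
    moreover have "coprime (x mod n + y mod n) n"
      using xy by (metis coprime_mod_left mod_add_eq)
    ultimately have "{x mod n, y mod n} \<in> unit_edges n" using n by (simp add: unit_edges_iff)
    then show ?thesis using f False by blast
  qed
  \<comment> \<open>The middle vertex \<open>- 1 - int m\<close> of the walk has sum 1 with
    \<open>int m + 2\<close> and sum -1 with \<open>int m\<close>.\<close>
  have step: "f (int (m + 2) mod n) = f (int m mod n)" for m
    using edge[of "int m + 2" "- 1 - int m"] edge[of "- 1 - int m" "int m"]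
    by (simp add: add.commute) (metis add_right_cancel add.commute)
  have iff: "f (int m mod n) = 0 \<longleftrightarrow> f 0 = 0" for m
  proof (induction m rule: nat_induct2)
    case 1
    show ?case using edge[of 0 1] n by (auto simp: add_eq_0_iff)
  next
    case (step m)
    then show ?case using \<open>\<And>m. f (int (m + 2) mod n) = f (int m mod n)\<close> by metis
  qed simp
  have "f x = 0 \<longleftrightarrow> f 0 = 0" if "x \<in> {0..<n}" for x using iff[of "nat x"] that by simp
  with zero show ?thesis by blast
qed

section \<open>Triangles and four-cycles by the Chinese remainder theorem\<close>

text \<open>Choose \<open>z\<close> congruent to 1 modulo \<open>a\<close> and to 2 modulo
  \<open>b\<close>. Then \<open>z\<close> and \<open>z + 1\<close> have residues 1, 2 modulo
  \<open>a\<close> and 2, 3 modulo \<open>b\<close>, all units because \<open>a\<close> is odd and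
  \<open>b\<close> is coprime to 6.\<close>

lemma triangle_in_unit_graph:
  fixes a b :: int
  assumes "coprime a b" "coprime b 6" "1 < b" "odd a" "0 < a"
  obtains z where "{0, 1} \<in> unit_edges (a * b)" "{1, z} \<in> unit_edges (a * b)"
    "{0, z} \<in> unit_edges (a * b)" "1 \<noteq> z" "0 \<noteq> z"
proof -
  let ?n = "a * b"
  have "1 * b \<le> ?n" using assms by (intro mult_right_mono) auto
  then have n: "1 < ?n" using assms(3) by linarith
  have b: "coprime 2 b" "coprime 3 b"
    using assms(2) coprime_mult_right_iff[of b 2 3] by (simp_all add: coprime_commute)
  obtain y where y: "[y = 1] (mod a)" "[y = 2] (mod b)"
    using binary_chinese_remainder_int[OF assms(1)] by blast
  have y': "[y + 1 = 2] (mod a)" "[y + 1 = 3] (mod b)"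
    using cong_add[OF y(1) cong_refl[of 1]] cong_add[OF y(2) cong_refl[of 1]] by simp_all
  define z where "z = y mod ?n"
  have z: "z \<in> {0..<?n}" using n by (simp add: z_def)
  have "coprime y ?n"
    using cong_imp_coprime[OF cong_sym[OF y(1)]] cong_imp_coprime[OF cong_sym[OF y(2)]] b by simp
  then have cop: "coprime z ?n" by (simp only: z_def coprime_mod_left)
  have "coprime (y + 1) ?n"
    using cong_imp_coprime[OF cong_sym[OF y'(1)]] cong_imp_coprime[OF cong_sym[OF y'(2)]] b assms(4)
    by simp
  then have cop': "coprime (z + 1) ?n"
    unfolding z_def by (metis coprime_mod_left mod_add_left_eq)
  have "z \<noteq> 0"
  proof
    assume "z = 0"
    with cop have "is_unit ?n" by (simp only: coprime_0_left_iff)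
    then have "\<bar>?n\<bar> = 1" by (simp only: zdvd1_eq)
    then show False using n by linarith
  qed
  moreover have "z \<noteq> 1"
  proof
    \<comment> \<open>The residues 1 and 2 differ modulo \<open>b\<close>, since
      \<open>1 < b\<close>.\<close>
    assume "z = 1"
    then have "[y = 1] (mod b)" by (metis cong_def mod_mult_left_eq mod_mod_cancel dvd_triv_right z_def)
    with y(2) have "[2 = 1] (mod b)" using cong_sym cong_trans by blast
    then have "b dvd 1" by (simp add: cong_iff_dvd_diff)
    then show False using assms(3) by simp
  qed
  ultimately show ?thesis
    using that[of z] n z cop cop' by (simp add: unit_edges_iff add.commute)
qed

text \<open>The cycle is 0, 1, \<open>z\<close>, -1 with \<open>z\<close> congruent to 0 modulo
  \<open>a\<close> and to 2 modulo \<open>b\<close>. Its sums are 1, \<open>z + 1\<close>,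
  \<open>z - 1\<close>, -1, where the middle two have residues 1, -1 modulo \<open>a\<close> and 3,
  1 modulo \<open>b\<close>.\<close>

lemma four_cycle_in_unit_graph:
  fixes a b :: int
  assumes "coprime a b" "coprime b 6" "1 < b" "even a" "0 < a"
  obtains z where "distinct [0, 1, z, a * b - 1]" "{0, 1} \<in> unit_edges (a * b)"
    "{1, z} \<in> unit_edges (a * b)" "{z, a * b - 1} \<in> unit_edges (a * b)"
    "{a * b - 1, 0} \<in> unit_edges (a * b)"
proof -
  let ?n = "a * b"
  have "2 * 2 \<le> ?n" using assms by (intro mult_mono) auto
  then have n: "2 < ?n" by simp
  have b: "coprime 2 b" "coprime 3 b"
    using assms(2) coprime_mult_right_iff[of b 2 3] by (simp_all add: coprime_commute)
  obtain y where y: "[y = 0] (mod a)" "[y = 2] (mod b)"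
    using binary_chinese_remainder_int[OF assms(1)] by blast
  have y': "[y + 1 = 1] (mod a)" "[y + 1 = 3] (mod b)" "[y - 1 = - 1] (mod a)" "[y - 1 = 1] (mod b)"
    using cong_add[OF y(1) cong_refl[of 1]] cong_add[OF y(2) cong_refl[of 1]]
      cong_diff[OF y(1) cong_refl[of 1]] cong_diff[OF y(2) cong_refl[of 1]] by simp_all
  define z where "z = y mod ?n"
  have z: "z \<in> {0..<?n}" using n by (simp add: z_def)
  have "coprime (y + 1) ?n"
    using cong_imp_coprime[OF cong_sym[OF y'(1)]] cong_imp_coprime[OF cong_sym[OF y'(2)]] b by simp
  then have cop: "coprime (z + 1) ?n"
    unfolding z_def by (metis coprime_mod_left mod_add_left_eq)
  have "coprime (y - 1) ?n"
    using cong_imp_coprime[OF cong_sym[OF y'(3)]] cong_imp_coprime[OF cong_sym[OF y'(4)]] by simp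
  \<comment> \<open>The vertex \<open>?n - 1\<close> represents -1, so this sum is
    \<open>y - 1\<close> modulo \<open>?n\<close>.\<close>
  then have "coprime (z + (?n - 1)) ?n"
    unfolding z_def by (metis coprime_mod_left mod_add_left_eq mod_add_self2 add_diff_eq add_diff_eq diff_add_eq)
  moreover have "coprime (?n - 1) ?n" by (rule coprime_diff_one_left)
  \<comment> \<open>Parity separates \<open>z\<close> from the odd vertices 1 and
    \<open>?n - 1\<close>; it differs from 0 because the odd number \<open>b > 1\<close> does not
    divide 2.\<close>
  moreover have "even z" using y(1) assms(4)
    by (metis cong_0_iff dvd_mod dvd_mult2 dvd_trans z_def)
  then have "z \<noteq> 1" "z \<noteq> ?n - 1" using assms(4) by auto
  moreover have "z \<noteq> 0"
  proof
    assume "z = 0"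
    then have "b dvd y" by (metis dvd_mult_right mod_0_imp_dvd z_def)
    with y(2) have "b dvd 2" by (metis cong_dvd_iff cong_sym dvd_refl cong_0_iff cong_trans)
    then have "is_unit b" using b(1) by (metis coprime_common_divisor dvd_refl)
    then show False using assms(3) by simp
  qed
  ultimately show ?thesis
    using that[of z] n z cop by (simp add: unit_edges_iff add.commute)
qed

text \<open>At least one of the distinct odd primes \<open>p\<close>, \<open>q\<close> is not 3, and
  its power serves as \<open>b\<close>. The factor \<open>r\<close> collects the rest of
  \<open>n\<close>: a power of the third prime or of 2.\<close>

lemma split_off_prime_power_coprime_6:
  fixes p q r :: nat
  assumes "prime p" "prime q" "odd p" "odd q" "p \<noteq> q" "1 \<le> i" "1 \<le> j" "coprime r p" "coprime r q"
  obtains a b where "p ^ i * q ^ j * r = a * b" "coprime a b" "coprime b 6" "1 < b"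
proof -
  have cop6: "coprime (s ^ k) 6" if "prime s" "odd s" "s \<noteq> 3" for s k :: nat
  proof -
    have "coprime s 2" "coprime s 3" using that primes_coprime[of s 3] by auto
    then have "coprime s (2 * 3)" by (simp only: coprime_mult_right_iff)
    then show ?thesis by simp
  qed
  have cop: "coprime p q" using assms by (simp add: primes_coprime)
  show ?thesis
  proof (cases "p = 3")
    case False
    show ?thesis
      by (rule that[of "q ^ j * r" "p ^ i"])
        (use assms cop cop6[of p i] False one_less_power[OF prime_gt_1_nat, of p i] in \<open>auto simp: coprime_commute\<close>)
  next
    case True
    show ?thesis
      by (rule that[of "p ^ i * r" "q ^ j"])
        (use assms cop cop6[of q j] True one_less_power[OF prime_gt_1_nat, of q j] in \<open>auto simp: coprime_commute\<close>)
  qed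
qed

section \<open>Code parameters for the two families of \<open>n\<close>\<close>

lemma dual_code_odd:
  fixes p1 p2 p3 n1 n2 n3 n :: nat
  assumes "prime p1" "prime p2" "prime p3" "odd p1" "odd p2" "odd p3"
    "p1 \<noteq> p2" "p1 \<noteq> p3" "p2 \<noteq> p3" "1 \<le> n1" "1 \<le> n2"
    and n: "n = p1 ^ n1 * p2 ^ n2 * p3 ^ n3" and F: "CARD('f::field) = 2"
    and H: "is_incidence_matrix H (unit_graph (residue_ring (int n)))"
  shows "is_code 2 ((n - 1) * totient n div 2) ((n - 1) * (totient n - 2) div 2) 3
    (dual_code (dim_col H) (code_of H :: 'f vec set))"
proof -
  have cop: "coprime (p3 ^ n3) p1" "coprime (p3 ^ n3) p2" using assms by (simp_all add: primes_coprime)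
  obtain a b where ab: "n = a * b" "coprime a b" "coprime b 6" "1 < b"
    using split_off_prime_power_coprime_6[OF assms(1,2,4,5,7) assms(10,11) cop] n by metis
  have "odd n" using assms by simp
  then have a: "odd a" "0 < a" using ab(1) by (auto intro: Nat.gr0I)
  have "1 * b \<le> n" unfolding ab(1) using a by (intro mult_right_mono) auto
  then have n1: "1 < n" using ab(4) by linarith
  let ?n = "int n" and ?E = "unit_edges (int n)"
  have two: "(1 :: 'f) + 1 = 0"
  \<comment> \<open>The characteristic divides the cardinality 2 and is not 1.\<close>
  proof -
    have "CHAR('f) dvd 2" using CHAR_dvd_CARD[where 'a = 'f] F by simp
    then have "CHAR('f) = 2" using CHAR_not_1'[where 'a = 'f] by (metis One_nat_def prime_nat_iff two_is_prime_nat)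
    then have "of_nat 2 = (0 :: 'f)" using of_nat_CHAR[where 'a = 'f] by simp
    then show ?thesis by simp
  qed
  have int_ab: "?n = int a * int b" "coprime (int a) (int b)"
    "coprime (int b) 6" "1 < int b" "odd (int a)" "0 < int a"
    using ab a coprime_int_iff[of b 6] by simp_all
  obtain z where z: "{0, 1} \<in> ?E" "{1, z} \<in> ?E" "{0, z} \<in> ?E" "1 \<noteq> z" "0 \<noteq> z"
    by (rule triangle_in_unit_graph[OF int_ab(2-6), folded int_ab(1)])
  obtain w :: "int set \<Rightarrow> 'f"
    where w: "\<And>x. (\<Sum>e\<in>{e\<in>?E. x \<in> e}. w e) = 0" "card {e\<in>?E. w e \<noteq> 0} = 3"
    by (rule triangle_word[OF finite_unit_edges two zero_neq_one z(4,5,1,2,3)]) (rule that)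
  have "is_code CARD('f) (card ?E) (card ?E - (card {0..<?n} - 1)) 3
    (dual_code (dim_col H) (code_of H :: 'f vec set))"
  proof (rule is_code_dual_incidence[OF _ _ unit_edges_doubleton _ _ alternating_zero _ w])
    show "is_incidence_matrix H ({0..<?n}, ?E)" using H n1 by (simp add: unit_graph_residue_ring)
    show "3 \<le> card {e\<in>?E. u e \<noteq> 0}"
      if "\<And>x. x \<in> {0..<?n} \<Longrightarrow> (\<Sum>e\<in>{e\<in>?E. x \<in> e}. u e) = 0" "\<exists>e\<in>?E. u e \<noteq> 0" for u :: "int set \<Rightarrow> 'f"
      using balanced_support(2)[OF finite_unit_edges unit_edges_doubleton that] .
    show "(\<lambda>_. 1) x + (\<lambda>_. 1) y = (0 :: 'f)" for x y :: int using two by simp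
  qed (use n1 two in auto)
  moreover have E: "2 * card ?E = (n - 1) * totient n"
    using two_card_unit_edges[of ?n] n1 \<open>odd n\<close> by simp
  then have "(n - 1) * (totient n - 2) = 2 * (card ?E - (n - 1))"
    by (simp add: diff_mult_distrib2)
  then have "(n - 1) * (totient n - 2) div 2 = card ?E - (n - 1)" by simp
  moreover have "(n - 1) * totient n div 2 = card ?E" unfolding E[symmetric] by simp
  ultimately show ?thesis using F by simp
qed

lemma dual_code_even:
  fixes p1 p2 m n1 n2 n :: nat
  assumes "prime p1" "prime p2" "odd p1" "odd p2" "p1 \<noteq> p2" "1 \<le> m" "1 \<le> n1" "1 \<le> n2"
    and n: "n = 2 ^ m * p1 ^ n1 * p2 ^ n2"
    and H: "is_incidence_matrix H (unit_graph (residue_ring (int n)))"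
  shows "is_code CARD('g::field) (n * totient n div 2) ((n * (totient n - 2) + 2) div 2) 4
    (dual_code (dim_col H) (code_of H :: 'g vec set))"
proof -
  have cop: "coprime (2 ^ m) p1" "coprime (2 ^ m) p2" using assms by simp_all
  obtain a b where ab: "n = a * b" "coprime a b" "coprime b 6" "1 < b"
    using split_off_prime_power_coprime_6[OF assms(1-5) assms(7,8) cop] n by (metis mult.assoc mult.commute)
  have "odd b" using ab(3) by (metis coprime_common_divisor_nat even_numeral dvd_refl odd_one)
  have "even n" "0 < n" using assms by (auto simp: prime_gt_0_nat)
  \<comment> \<open>As \<open>b\<close> is odd, the factor 2 of \<open>n\<close> lies in
    \<open>a\<close>, as the four-cycle requires.\<close>
  then have a: "even a" "0 < a" using ab(1) \<open>odd b\<close> by (auto intro: Nat.gr0I)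
  have "2 * 2 \<le> n" unfolding ab(1) using a ab(4) by (intro mult_le_mono) auto
  then have n2: "2 < n" by simp
  let ?n = "int n" and ?E = "unit_edges (int n)"
  let ?c = "\<lambda>x :: int. if even x then 1 else - 1 :: 'g"
  \<comment> \<open>A unit modulo an even number is odd, so the graph is bipartite by parity. This
    makes \<open>?c\<close> change sign along edges and rules out triangles.\<close>
  have parity: "even x \<longleftrightarrow> odd y" if "{x, y} \<in> ?E" for x y
  proof -
    have "odd (x + y)"
      using that \<open>even n\<close> not_coprimeI[of 2 "x + y" ?n] by (auto simp: unit_edges_iff)
    then show ?thesis by simp
  qed
  have int_ab: "?n = int a * int b" "coprime (int a) (int b)"
    "coprime (int b) 6" "1 < int b" "even (int a)" "0 < int a"
    using ab a coprime_int_iff[of b 6] by simp_all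
  obtain z where z: "distinct [0, 1, z, ?n - 1]" "{0, 1} \<in> ?E" "{1, z} \<in> ?E" "{z, ?n - 1} \<in> ?E"
    "{?n - 1, 0} \<in> ?E"
    by (rule four_cycle_in_unit_graph[OF int_ab(2-6), folded int_ab(1)])
  obtain w :: "int set \<Rightarrow> 'g"
    where w: "\<And>x. (\<Sum>e\<in>{e\<in>?E. x \<in> e}. w e) = 0" "card {e\<in>?E. w e \<noteq> 0} = 4"
    by (rule four_cycle_word[where 'a = 'g, OF finite_unit_edges z]) (rule that)
  have "is_code CARD('g) (card ?E) (card ?E - (card {0..<?n} - 1)) 4
    (dual_code (dim_col H) (code_of H :: 'g vec set))"
  proof (rule is_code_dual_incidence[OF _ _ unit_edges_doubleton _ _ alternating_zero _ w])
    show "is_incidence_matrix H ({0..<?n}, ?E)" using H n2 by (simp add: unit_graph_residue_ring)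
    show "4 \<le> card {e\<in>?E. u e \<noteq> 0}"
      if "\<And>x. x \<in> {0..<?n} \<Longrightarrow> (\<Sum>e\<in>{e\<in>?E. x \<in> e}. u e) = 0" "\<exists>e\<in>?E. u e \<noteq> 0" for u :: "int set \<Rightarrow> 'g"
      using balanced_support(1)[OF finite_unit_edges unit_edges_doubleton that] parity by blast
    show "?c x + ?c y = 0" if "{x, y} \<in> ?E" for x y using parity[OF that] by simp
  qed (use n2 \<open>even n\<close> in auto)
  moreover have E: "2 * card ?E = n * totient n"
    using two_card_unit_edges[of ?n] n2 \<open>even n\<close> by simp
  moreover have "(n * (totient n - 2) + 2) div 2 = card ?E - (n - 1)"
  proof -
    \<comment> \<open>Ensures that \<open>totient n - 2\<close> is not truncated; otherwise adding 2
      afterwards would give the wrong value.\<close>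
    have "1 < totient n" using n2 by (rule totient_gt_1)
    then obtain k where "totient n = 2 + k" using nat_le_iff_add[of 2 "totient n"] by auto
    then have "n * (totient n - 2) + n * 2 = n * totient n" by (simp add: distrib_left)
    then have "n * (totient n - 2) + 2 = 2 * (card ?E - (n - 1))" using E n2 by simp
    then show ?thesis by simp
  qed
  moreover have "n * totient n div 2 = card ?E" unfolding E[symmetric] by simp
  ultimately show ?thesis by simp
qed


theorem corollary5p8:
  shows
    "(\<forall>p1 p2 p3 n1 n2 n3 n :: nat. \<forall>H :: int mat.
        prime p1 \<and> prime p2 \<and> prime p3 \<and> odd p1 \<and> odd p2 \<and> odd p3 \<and>
        p1 \<noteq> p2 \<and> p1 \<noteq> p3 \<and> p2 \<noteq> p3 \<and> n1 \<ge> 1 \<and> n2 \<ge> 1 \<and> n3 \<ge> 1 \<and>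
        n = p1 ^ n1 * p2 ^ n2 * p3 ^ n3 \<and>
        CARD('f::field) = 2 \<and>
        is_incidence_matrix H (unit_graph (residue_ring (int n)))
        \<longrightarrow> is_code 2 ((n - 1) * totient n div 2) ((n - 1) * (totient n - 2) div 2) 3
              (dual_code (dim_col H) (code_of H :: 'f vec set)))
     \<and>
     (\<forall>p1 p2 m n1 n2 n q :: nat. \<forall>H :: int mat.
        prime p1 \<and> prime p2 \<and> odd p1 \<and> odd p2 \<and> p1 \<noteq> p2 \<and>
        m \<ge> 1 \<and> n1 \<ge> 1 \<and> n2 \<ge> 1 \<and>
        n = 2 ^ m * p1 ^ n1 * p2 ^ n2 \<and>
        prime q \<and> odd q \<and> CARD('g::field) = q \<and>
        is_incidence_matrix H (unit_graph (residue_ring (int n)))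
        \<longrightarrow> is_code q (n * totient n div 2) ((n * (totient n - 2) + 2) div 2) 4
              (dual_code (dim_col H) (code_of H :: 'g vec set)))"
proof (intro conjI allI impI, goal_cases)
  case (1 p1 p2 p3 n1 n2 n3 n H)
  then show ?case by (elim conjE) (rule dual_code_odd[of p1 p2 p3 n1 n2 n n3]; assumption)
next
  case (2 p1 p2 m n1 n2 n q H)
  then have q: "CARD('g) = q" by blast
  from 2 show ?case unfolding q[symmetric] by (elim conjE) (rule dual_code_even[of p1 p2 m n1 n2]; assumption)
qed

end
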